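(* Let $X, X_1, X_2,\ldots$ be independent and identically distributed real-valued random variables with common cumulative distribution function $F$, whose lower endpoint $lep(F)$ and upper endpoint $uep(F)$ are both finite. Put $p_1=\mathbb{P}(X=lep(F))$, $p_2=\mathbb{P}(X=uep(F))$, $p_3=1-p_1-p_2$, and suppose $p_i>0$ for $i\in\{1,2,3\}$. For $n\geq 1$ let $M_{n,1}$ be the number of $j\in\{1,\ldots,n\}$ with $X_j=lep(F)$ and $M_{n,2}$ the number of $j\in\{1,\ldots,n\}$ with $X_j=uep(F)$. If $\Delta p=p_1-p_2>0$, then for any $\beta\in\,]0,\Delta p[$, $$\liminf_{n\to+\infty}\mathbb{P}\left(M_{n,1}-M_{n,2}\geq n\beta\right)=1.$$ Symmetrically, if $\Delta p=p_2-p_1>0$, then for any $\beta\in\,]0,\Delta p[$, $\liminf_{n\to+\infty}\mathbb{P}\left(M_{n,2}-M_{n,1}\geq n\beta\right)=1$.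
   Context: Endpoints: $lep(F)=\inf\{x\in\mathbb{R}: F(x)>0\}$ and $uep(F)=\sup\{x\in\mathbb{R}: F(x)<1\}$. *)

theory Defs
  imports "HOL-Probability.Probability"
begin

(* The endpoints live in the extended reals, so that their finiteness is a genuine hypothesis. *)

definition lep :: "(real \<Rightarrow> real) \<Rightarrow> ereal" where
  "lep F = Inf (ereal ` {x. F x > 0})"

definition uep :: "(real \<Rightarrow> real) \<Rightarrow> ereal" where
  "uep F = Sup (ereal ` {x. F x < 1})"

definition num_at :: "(nat \<Rightarrow> 'a \<Rightarrow> real) \<Rightarrow> ereal \<Rightarrow> nat \<Rightarrow> 'a \<Rightarrow> nat" where
  "num_at X e n \<omega> = card {j \<in> {1..n}. ereal (X j \<omega>) = e}"

end

(* The difference of the two counts is a sum of i.i.d. variables with values in {-1, 0, 1} and mean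
   p1 - p2, so Hoeffding's inequality bounds the probability that it stays below n * beta by
   exp (- n * (p1 - p2 - beta)^2 / 2). *)

theory Submission
  imports Defs "HOL-Real_Asymp.Real_Asymp"
begin

text \<open>Each cardinality is a sum of indicators. Merging them into one sum over the sample gives
  the form that Hoeffding's inequality accepts.\<close>

lemma diff_num_at_eq_sum:
  "real (num_at X a n \<omega>) - real (num_at X b n \<omega>) =
    (\<Sum>j\<in>{1..n}. of_bool (ereal (X j \<omega>) = a) - of_bool (ereal (X j \<omega>) = b))"
  by (simp add: num_at_def sum_subtractf sum_of_bool_eq Int_def conj_commute)

text \<open>Hoeffding's lower-tail bound for the sample mean controls the complementary event. The
  points \<open>a\<close> and \<open>b\<close> are kept arbitrary so that exchanging them yields the
  symmetric half of the theorem.\<close>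

lemma (in prob_space) prob_diff_num_at_ge:
  fixes X :: "'a \<Rightarrow> real" and Xs :: "nat \<Rightarrow> 'a \<Rightarrow> real" and a b :: ereal and \<beta> :: real
  assumes X [measurable]: "random_variable borel X"
    and indep: "indep_vars (\<lambda>_. borel) Xs {1..n}"
    and distr: "\<And>j. j \<in> {1..n} \<Longrightarrow> distr M borel (Xs j) = distr M borel X"
    and n: "n > 0"
  defines "\<mu> \<equiv> prob {\<omega> \<in> space M. ereal (X \<omega>) = a} - prob {\<omega> \<in> space M. ereal (X \<omega>) = b}"
  assumes \<beta>: "\<beta> < \<mu>"
  shows "1 - exp (- real n * (\<mu> - \<beta>)\<^sup>2 / 2) \<le>
    prob {\<omega> \<in> space M. real (num_at Xs a n \<omega>) - real (num_at Xs b n \<omega>) \<ge> real n * \<beta>}"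
proof -
  \<comment> \<open>Each summand is a fixed Borel function of one observation, so independence and
    equality of laws pass from \<open>Xs\<close> to the summands by composition.\<close>
  define g :: "real \<Rightarrow> real" where "g = (\<lambda>x. of_bool (ereal x = a) - of_bool (ereal x = b))"
  have g [measurable]: "g \<in> borel_measurable borel"
    unfolding g_def by measurable
  have Xs [measurable]: "random_variable borel (Xs j)" if "j \<in> {1..n}" for j
    using indep that unfolding indep_vars_def by blast
  define S where "S = (\<lambda>\<omega>. \<Sum>j\<in>{1..n}. g (Xs j \<omega>))"
  have S [measurable]: "random_variable borel S"
    unfolding S_def by measurable
  have expect: "expectation (\<lambda>\<omega>. g (X \<omega>)) = \<mu>"
  proof -
    have "expectation (\<lambda>\<omega>. g (X \<omega>)) =
      expectation (\<lambda>\<omega>. indicator {\<omega> \<in> space M. ereal (X \<omega>) = a} \<omega> -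
        indicator {\<omega> \<in> space M. ereal (X \<omega>) = b} \<omega>)"
      by (rule Bochner_Integration.integral_cong) (auto simp: g_def indicator_def)
    also have "\<dots> = \<mu>"
      by (subst Bochner_Integration.integral_diff)
        (auto simp: \<mu>_def integrable_indicator_iff less_top[symmetric])
    finally show ?thesis .
  qed
  \<comment> \<open>The range [-1, 1] has length 2, which turns the general exponent -2 n eps^2 / (b
    - a)^2 into -n eps^2 / 2.\<close>
  interpret Hoeffding_ineq_iid M "{1..n}" "\<lambda>j \<omega>. g (Xs j \<omega>)" "\<lambda>\<omega>. g (X \<omega>)" "-1" 1 \<mu>
  proof unfold_locales
    show "indep_vars (\<lambda>_. borel) (\<lambda>j \<omega>. g (Xs j \<omega>)) {1..n}"
      by (rule indep_vars_compose2[OF indep]) simp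
    show "distr M borel (\<lambda>\<omega>. g (Xs j \<omega>)) = distr M borel (\<lambda>\<omega>. g (X \<omega>))" if "j \<in> {1..n}" for j
    proof -
      have "distr M borel (\<lambda>\<omega>. g (Xs j \<omega>)) = distr (distr M borel (Xs j)) borel g"
        using that by (subst distr_distr) (auto simp: comp_def)
      also have "\<dots> = distr M borel (\<lambda>\<omega>. g (X \<omega>))"
        by (subst distr[OF that], subst distr_distr) (auto simp: comp_def)
      finally show ?thesis .
    qed
  qed (auto simp: g_def expect[unfolded g_def])
  \<comment> \<open>The deviation is chosen as \<open>\<mu> - \<beta>\<close>, so that the
    threshold, mean minus deviation, is exactly \<open>\<beta>\<close>.\<close>
  have "prob {\<omega> \<in> space M. S \<omega> / n \<le> \<beta>} \<le> exp (- real n * (\<mu> - \<beta>)\<^sup>2 / 2)"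
    using Hoeffding_ineq_le'[of "\<mu> - \<beta>"] n \<beta> by (simp add: S_def)
  \<comment> \<open>The complement is the strict event \<open>S \<omega> < n * \<beta>\<close>;
    dividing by the positive \<open>n\<close> places it inside the non-strict event that Hoeffding
    bounds.\<close>
  moreover have "1 - prob {\<omega> \<in> space M. S \<omega> \<ge> real n * \<beta>} \<le> prob {\<omega> \<in> space M. S \<omega> / n \<le> \<beta>}"
  proof -
    have "1 - prob {\<omega> \<in> space M. S \<omega> \<ge> real n * \<beta>} = prob {\<omega> \<in> space M. \<not> S \<omega> \<ge> real n * \<beta>}"
      by (rule prob_neg[symmetric]) measurable
    also have "\<dots> \<le> prob {\<omega> \<in> space M. S \<omega> / n \<le> \<beta>}"
      using n by (intro finite_measure_mono) (auto simp: field_simps)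
    finally show ?thesis .
  qed
  ultimately show ?thesis
    by (simp add: diff_num_at_eq_sum S_def g_def)
qed

text \<open>The probabilities are squeezed between the exponential bound, which tends to 1, and the
  constant 1.\<close>

lemma (in prob_space) tendsto_prob_diff_num_at:
  fixes X :: "'a \<Rightarrow> real" and Xs :: "nat \<Rightarrow> 'a \<Rightarrow> real" and a b :: ereal and \<beta> :: real
  assumes X: "random_variable borel X"
    and indep: "indep_vars (\<lambda>_. borel) Xs {1..}"
    and distr: "\<And>j. j \<ge> 1 \<Longrightarrow> distr M borel (Xs j) = distr M borel X"
  defines "\<mu> \<equiv> prob {\<omega> \<in> space M. ereal (X \<omega>) = a} - prob {\<omega> \<in> space M. ereal (X \<omega>) = b}"
  assumes \<beta>: "\<beta> < \<mu>"
  shows "(\<lambda>n. prob {\<omega> \<in> space M.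
    real (num_at Xs a n \<omega>) - real (num_at Xs b n \<omega>) \<ge> real n * \<beta>}) \<longlonglongrightarrow> 1"
proof (rule tendsto_sandwich)
  \<comment> \<open>Naming the rate reduces the limit to a single parameter with known sign: the gap
    between \<open>\<beta>\<close> and \<open>\<mu>\<close> makes it positive.\<close>
  define c where "c = (\<mu> - \<beta>)\<^sup>2 / 2"
  have "c > 0"
    using \<beta> by (simp add: c_def)
  then have "(\<lambda>n. 1 - exp (- real n * c)) \<longlonglongrightarrow> 1"
    by real_asymp
  then show "(\<lambda>n. 1 - exp (- real n * (\<mu> - \<beta>)\<^sup>2 / 2)) \<longlonglongrightarrow> 1"
    by (simp add: c_def)
  show "\<forall>\<^sub>F n in sequentially. 1 - exp (- real n * (\<mu> - \<beta>)\<^sup>2 / 2) \<le> prob {\<omega> \<in> space M.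
    real (num_at Xs a n \<omega>) - real (num_at Xs b n \<omega>) \<ge> real n * \<beta>}"
    using eventually_gt_at_top[of 0]
  proof eventually_elim
    case (elim n)
    have "indep_vars (\<lambda>_. borel) Xs {1..n}"
      by (rule indep_vars_subset[OF indep]) auto
    then show ?case
      using elim \<beta> distr X unfolding \<mu>_def by (intro prob_diff_num_at_ge) auto
  qed
qed auto

theorem mainTheorem7:
  fixes M :: "'a measure"
    and X :: "'a \<Rightarrow> real"
    and Xs :: "nat \<Rightarrow> 'a \<Rightarrow> real"
    and F :: "real \<Rightarrow> real"
    and p1 p2 p3 :: real
    and M1 M2 :: "nat \<Rightarrow> 'a \<Rightarrow> nat"
  assumes "prob_space M"
    and "prob_space.indep_vars M (\<lambda>_. borel) (Xs(0 := X)) UNIV"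
    and "\<And>j. j \<ge> 1 \<Longrightarrow> distr M borel (Xs j) = distr M borel X"
    and "F = cdf (distr M borel X)"
    and "\<bar>lep F\<bar> \<noteq> \<infinity>" and "\<bar>uep F\<bar> \<noteq> \<infinity>"
    and "p1 = measure M {\<omega> \<in> space M. ereal (X \<omega>) = lep F}"
    and "p2 = measure M {\<omega> \<in> space M. ereal (X \<omega>) = uep F}"
    and "p3 = 1 - p1 - p2"
    and "p1 > 0" and "p2 > 0" and "p3 > 0"
    and "M1 = num_at Xs (lep F)"
    and "M2 = num_at Xs (uep F)"
  shows "(p1 - p2 > 0 \<longrightarrow> (\<forall>\<beta> \<in> {0<..<p1 - p2}.
            liminf (\<lambda>n. ereal (measure M
              {\<omega> \<in> space M. real (M1 n \<omega>) - real (M2 n \<omega>) \<ge> real n * \<beta>})) = 1)) \<and>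
         (p2 - p1 > 0 \<longrightarrow> (\<forall>\<beta> \<in> {0<..<p2 - p1}.
            liminf (\<lambda>n. ereal (measure M
              {\<omega> \<in> space M. real (M2 n \<omega>) - real (M1 n \<omega>) \<ge> real n * \<beta>})) = 1))"
proof -
  interpret prob_space M by fact
  \<comment> \<open>Index 0 of the joint family carries \<open>X\<close>, so its measurability is
    part of the independence assumption. On the indices from 1 on, the updated family coincides with
    \<open>Xs\<close>.\<close>
  have X: "random_variable borel X"
    using assms(2) unfolding indep_vars_def by (metis UNIV_I fun_upd_same)
  have "indep_vars (\<lambda>_. borel) (Xs(0 := X)) {1..}"
    by (rule indep_vars_subset[OF assms(2)]) auto
  then have indep: "indep_vars (\<lambda>_. borel) Xs {1..}"
    by (rule indep_vars_cong[THEN iffD1, rotated -1]) auto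
  note lim = tendsto_prob_diff_num_at[OF X indep assms(3)]
  \<comment> \<open>The probabilities converge, so their liminf is the limit, once carried over to
    the extended reals. The second case is the same with the endpoints exchanged.\<close>
  have "liminf (\<lambda>n. ereal (prob
      {\<omega> \<in> space M. real (M1 n \<omega>) - real (M2 n \<omega>) \<ge> real n * \<beta>})) = 1"
    if "\<beta> < p1 - p2" for \<beta>
    using lim[of \<beta> "lep F" "uep F"] that assms(7,8,13,14)
    by (intro lim_imp_Liminf) (auto simp: one_ereal_def)
  moreover have "liminf (\<lambda>n. ereal (prob
      {\<omega> \<in> space M. real (M2 n \<omega>) - real (M1 n \<omega>) \<ge> real n * \<beta>})) = 1"
    if "\<beta> < p2 - p1" for \<beta>
    using lim[of \<beta> "uep F" "lep F"] that assms(7,8,13,14)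
    by (intro lim_imp_Liminf) (auto simp: one_ereal_def)
  ultimately show ?thesis
    by simp
qed

end
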